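(* If there exists $\alpha_0(x)$ with $\int\alpha_0(u)^2du<\infty$ and $$E[g(W,\gamma,\theta_0)]=\int\alpha_0(u)[\gamma(u)-\gamma_0(u)]du\quad\text{for all }\gamma\text{ with }\int\gamma(u)^2du<\infty,$$ then $$\psi(W,\gamma,\alpha,\theta)=g(W,\gamma,\theta)+\alpha(X)-\int\alpha(u)\gamma(u)du$$ is doubly robust.
   Context: $X$ is a function of the data observation $W$, continuously distributed with true pdf $\gamma_0$ (with respect to Lebesgue measure), $\int\gamma_0(u)^2du<\infty$; $E$ is expectation under the true distribution. $g(w,\gamma,\theta)$ is an identifying moment function depending on a possible first step density $\gamma$, and $\theta_0$ is the true parameter. With $\bar\psi(\gamma,\alpha,\theta)=E[\psi(W,\gamma,\alpha,\theta)]$, $\psi$ is doubly robust if $0=\bar\psi(\gamma,\alpha_0,\theta_0)=\bar\psi(\gamma_0,\alpha,\theta_0)$ for all $\gamma$ with $\int\gamma(u)^2du<\infty$ and all $\alpha$ with $\int\alpha(u)^2du<\infty$. *)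

theory Defs
  imports "HOL-Probability.Probability"
begin

definition sq_integrable :: "('x::euclidean_space \<Rightarrow> real) \<Rightarrow> bool" where
  "sq_integrable f \<longleftrightarrow>
     f \<in> borel_measurable lborel \<and> integrable lborel (\<lambda>u. (f u)\<^sup>2)"

definition is_pdf :: "'s measure \<Rightarrow> ('s \<Rightarrow> 'x::euclidean_space) \<Rightarrow> ('x \<Rightarrow> real) \<Rightarrow> bool" where
  "is_pdf M Y f \<longleftrightarrow> (\<forall>u. 0 \<le> f u) \<and> distributed M lborel Y (\<lambda>u. ennreal (f u))"

definition mean_moment ::
    "'s measure \<Rightarrow> ('s \<Rightarrow> 'w) \<Rightarrow> ('w \<Rightarrow> ('x \<Rightarrow> real) \<Rightarrow> ('x \<Rightarrow> real) \<Rightarrow> 't \<Rightarrow> real) \<Rightarrow>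
     ('x \<Rightarrow> real) \<Rightarrow> ('x \<Rightarrow> real) \<Rightarrow> 't \<Rightarrow> real" where
  "mean_moment M W \<psi> \<gamma> \<alpha> \<theta> = (\<integral>\<omega>. \<psi> (W \<omega>) \<gamma> \<alpha> \<theta> \<partial>M)"

text \<open>The Bochner integral of a non-integrable function is 0 by convention, so the
  existence of the expectations is required explicitly.\<close>

definition doubly_robust ::
    "'s measure \<Rightarrow> ('s \<Rightarrow> 'w) \<Rightarrow>
     ('w \<Rightarrow> ('x::euclidean_space \<Rightarrow> real) \<Rightarrow> ('x \<Rightarrow> real) \<Rightarrow> 't \<Rightarrow> real) \<Rightarrow>
     ('x \<Rightarrow> real) \<Rightarrow> ('x \<Rightarrow> real) \<Rightarrow> 't \<Rightarrow> bool" where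
  "doubly_robust M W \<psi> \<gamma>0 \<alpha>0 \<theta>0 \<longleftrightarrow>
     (\<forall>\<gamma>. sq_integrable \<gamma> \<longrightarrow>
        integrable M (\<lambda>\<omega>. \<psi> (W \<omega>) \<gamma> \<alpha>0 \<theta>0) \<and> mean_moment M W \<psi> \<gamma> \<alpha>0 \<theta>0 = 0) \<and>
     (\<forall>\<alpha>. sq_integrable \<alpha> \<longrightarrow>
        integrable M (\<lambda>\<omega>. \<psi> (W \<omega>) \<gamma>0 \<alpha> \<theta>0) \<and> mean_moment M W \<psi> \<gamma>0 \<alpha> \<theta>0 = 0)"

end

theory Submission imports Defs begin

text \<open>The correction term \<open>\<alpha>(X) - \<integral>\<alpha>\<gamma>\<close> has expectation \<open>- \<integral>\<alpha>(\<gamma> - \<gamma>\<^sub>0)\<close>, because \<open>\<gamma>\<^sub>0\<close> is the pdf of \<open>X\<close>.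
  At \<open>\<alpha> = \<alpha>\<^sub>0\<close> this cancels \<open>E[g(W,\<gamma>,\<theta>\<^sub>0)]\<close>; at \<open>\<gamma> = \<gamma>\<^sub>0\<close> both vanish.\<close>

text \<open>By AM-GM, \<open>2 * \<bar>f u * h u\<bar>\<close> is at most
  \<open>(f u)\<^sup>2 + (h u)\<^sup>2\<close>, so the product has an integrable majorant.\<close>

lemma sq_integrable_mult_integrable:
  assumes "sq_integrable f" and "sq_integrable h"
  shows "integrable lborel (\<lambda>u. f u * h u)"
proof (rule Bochner_Integration.integrable_bound)
  show "integrable lborel (\<lambda>u. (f u)\<^sup>2 + (h u)\<^sup>2)"
    using assms by (simp add: sq_integrable_def)
  show "(\<lambda>u. f u * h u) \<in> borel_measurable lborel"
    using assms by (auto simp: sq_integrable_def)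
  have "\<bar>f u * h u\<bar> \<le> (f u)\<^sup>2 + (h u)\<^sup>2" for u
  proof -
    have "2 * \<bar>f u * h u\<bar> \<le> (f u)\<^sup>2 + (h u)\<^sup>2"
      using sum_squares_bound[of "\<bar>f u\<bar>" "\<bar>h u\<bar>"] by (simp add: abs_mult)
    then show ?thesis by linarith
  qed
  then show "AE u in lborel. norm (f u * h u) \<le> norm ((f u)\<^sup>2 + (h u)\<^sup>2)"
    by simp
qed

text \<open>Change of variables along \<open>Y\<close>. Square-integrability of the density puts
  \<open>a * f\<close> in L1, so the expectation genuinely exists rather than being 0 by
  convention.\<close>

lemma is_pdf_expectation:
  assumes "is_pdf M Y f" and "sq_integrable f" and "sq_integrable a"
  shows "integrable M (\<lambda>\<omega>. a (Y \<omega>))"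
    and "(\<integral>\<omega>. a (Y \<omega>) \<partial>M) = (\<integral>u. a u * f u \<partial>lborel)"
proof -
  have d: "distributed M lborel Y (\<lambda>u. ennreal (f u))" and nn: "\<And>u. 0 \<le> f u"
    using assms(1) by (auto simp: is_pdf_def)
  have a: "a \<in> borel_measurable lborel"
    using assms(3) by (simp add: sq_integrable_def)
  show "integrable M (\<lambda>\<omega>. a (Y \<omega>))"
    using distributed_integrable[OF d a nn] sq_integrable_mult_integrable[OF assms(2,3)] by simp
  show "(\<integral>\<omega>. a (Y \<omega>) \<partial>M) = (\<integral>u. a u * f u \<partial>lborel)"
    using distributed_integral[OF d a nn] by (simp add: mult.commute)
qed

theorem theorem11:
  fixes M :: "'s measure" and N :: "'w measure"
    and W :: "'s \<Rightarrow> 'w" and X :: "'w \<Rightarrow> 'x::euclidean_space"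
    and g :: "'w \<Rightarrow> ('x \<Rightarrow> real) \<Rightarrow> 't \<Rightarrow> real"
    and \<gamma>0 \<alpha>0 :: "'x \<Rightarrow> real" and \<theta>0 :: 't
  assumes "prob_space M"
    and "W \<in> measurable M N"
    and "X \<in> measurable N borel"
    and "is_pdf M (\<lambda>\<omega>. X (W \<omega>)) \<gamma>0"
    and "sq_integrable \<gamma>0"
    and "sq_integrable \<alpha>0"
    and "\<And>\<gamma>. sq_integrable \<gamma> \<Longrightarrow> integrable M (\<lambda>\<omega>. g (W \<omega>) \<gamma> \<theta>0)"
    and "\<And>\<gamma>. sq_integrable \<gamma> \<Longrightarrow>
           (\<integral>\<omega>. g (W \<omega>) \<gamma> \<theta>0 \<partial>M) = (\<integral>u. \<alpha>0 u * (\<gamma> u - \<gamma>0 u) \<partial>lborel)"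
  shows "doubly_robust M W
           (\<lambda>w \<gamma> \<alpha> \<theta>. g w \<gamma> \<theta> + \<alpha> (X w) - (\<integral>u. \<alpha> u * \<gamma> u \<partial>lborel)) \<gamma>0 \<alpha>0 \<theta>0"
proof -
  interpret prob_space M by fact
  let ?\<psi> = "\<lambda>w \<gamma> \<alpha> \<theta>. g w \<gamma> \<theta> + \<alpha> (X w) - (\<integral>u. \<alpha> u * \<gamma> u \<partial>lborel)"
  \<comment> \<open>Keeping \<gamma> and \<alpha> arbitrary lets one formula serve both halves of
    double robustness.\<close>
  have moment: "integrable M (\<lambda>\<omega>. ?\<psi> (W \<omega>) \<gamma> \<alpha> \<theta>0)"
    "mean_moment M W ?\<psi> \<gamma> \<alpha> \<theta>0 =
       (\<integral>u. \<alpha>0 u * (\<gamma> u - \<gamma>0 u) \<partial>lborel) - (\<integral>u. \<alpha> u * (\<gamma> u - \<gamma>0 u) \<partial>lborel)"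
    if \<gamma>: "sq_integrable \<gamma>" and \<alpha>: "sq_integrable \<alpha>" for \<gamma> \<alpha>
  proof -
    note g = assms(7)[OF \<gamma>] and X = is_pdf_expectation[OF assms(4,5) \<alpha>]
    show "integrable M (\<lambda>\<omega>. ?\<psi> (W \<omega>) \<gamma> \<alpha> \<theta>0)"
      using g X(1) by simp
    \<comment> \<open>Linearity requires both products to be integrable; the subtracted integral is
      the expectation of \<open>\<alpha> (X (W \<omega>))\<close>.\<close>
    have "(\<integral>u. \<alpha> u * (\<gamma> u - \<gamma>0 u) \<partial>lborel) =
        (\<integral>u. \<alpha> u * \<gamma> u \<partial>lborel) - (\<integral>u. \<alpha> u * \<gamma>0 u \<partial>lborel)"
      using sq_integrable_mult_integrable[OF \<alpha>] \<gamma> assms(5) by (simp add: right_diff_distrib)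
    \<comment> \<open>The integral of \<open>\<alpha> u * \<gamma> u\<close> is constant in
      \<omega>, so it is its own expectation because \<open>M\<close> has total mass 1.\<close>
    then show "mean_moment M W ?\<psi> \<gamma> \<alpha> \<theta>0 =
       (\<integral>u. \<alpha>0 u * (\<gamma> u - \<gamma>0 u) \<partial>lborel) - (\<integral>u. \<alpha> u * (\<gamma> u - \<gamma>0 u) \<partial>lborel)"
      using g X assms(8)[OF \<gamma>] by (simp add: mean_moment_def prob_space)
  qed
  show ?thesis
    unfolding doubly_robust_def using moment assms(5,6) by simp
qed

end
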